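(* Let $q=p^l$ with $p$ prime, where $p\equiv 3 \bmod 4$ and $l$ odd do not hold simultaneously. Let $G(z)\in\mathbb{F}_q[z]^{k\times 2k}$ be a generator matrix, with rows $g_1(z),\dots,g_k(z)$, of a self-dual $(2k,k)$ convolutional code over $\mathbb{F}_q[z]$. Let $a,b\in\mathbb{F}_q^*$ with $a^2+b^2=0$ in $\mathbb{F}_q$, let $f(z)\in\mathbb{F}_q[z]^{2k}$ (a row vector) satisfy $f(z)f(z)^\top=-(a^{-1})^2$, and define $y_i(z):=f(z)g_i(z)^\top$ for $1\le i\le k$. Then $$\tilde G(z)=\begin{pmatrix}-a^{-1}&0&f(z)\\ a y_1(z)&b y_1(z)&g_1(z)\\ \vdots&\vdots&\vdots\\ a y_k(z)&b y_k(z)&g_k(z)\end{pmatrix}\in\mathbb{F}_q[z]^{(k+1)\times(2k+2)}$$ generates a self-dual $(2k+2,k+1)$ convolutional code.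
   Context: An $(n,k)$ convolutional code over $\mathbb{F}_q$ is an $\mathbb{F}_q[z]$-submodule $\mathcal{C}\subset\mathbb{F}_q[z]^n$ of rank $k$. A generator matrix of $\mathcal{C}$ is a matrix $G(z)\in\mathbb{F}_q[z]^{k\times n}$ whose rows form a basis of $\mathcal{C}$; one says $G(z)$ generates $\mathcal{C}$. The dual is $\mathcal{C}^\perp=\{f(z)\in\mathbb{F}_q[z]^n : f(z)c(z)^\top=0\ \forall c(z)\in\mathcal{C}\}$, and $\mathcal{C}$ is self-dual if $\mathcal{C}=\mathcal{C}^\perp$. *)

theory Defs
  imports
    "HOL-Computational_Algebra.Primes"
    "HOL-Computational_Algebra.Polynomial"
    "Jordan_Normal_Form.VS_Connect"
begin

abbreviation poly_space :: "nat \<Rightarrow> ('a::field poly, 'a poly vec) module" where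
  "poly_space n \<equiv> module_vec TYPE('a poly) n"

definition is_basis :: "nat \<Rightarrow> 'a::field poly vec set \<Rightarrow> 'a poly vec set \<Rightarrow> bool" where
  "is_basis n C B \<longleftrightarrow>
     B \<subseteq> C \<and>
     \<not> LinearCombinations.module.lin_dep class_ring (poly_space n) B \<and>
     LinearCombinations.module.span class_ring (poly_space n) B = C"

text \<open>Submodules of the free module of rank \<open>n\<close> over the principal ideal domain of
  polynomials are free, so having rank \<open>k\<close> means having a basis with \<open>k\<close> elements.\<close>

definition convolutional_code ::
  "nat \<Rightarrow> nat \<Rightarrow> 'a::{field,finite} poly vec set \<Rightarrow> bool" where
  "convolutional_code n k C \<longleftrightarrow>
     LinearCombinations.submodule class_ring C (poly_space n) \<and>
     (\<exists>B. finite B \<and> card B = k \<and> is_basis n C B)"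

text \<open>Distinctness is required because linear independence is a property of the set of
  rows and would not exclude repeated rows.\<close>

definition generator_matrix ::
  "nat \<Rightarrow> nat \<Rightarrow> 'a::{field,finite} poly vec set \<Rightarrow> 'a poly mat \<Rightarrow> bool" where
  "generator_matrix n k C G \<longleftrightarrow>
     G \<in> carrier_mat k n \<and> distinct (rows G) \<and> is_basis n C (set (rows G))"

definition dual_code ::
  "nat \<Rightarrow> 'a::{field,finite} poly vec set \<Rightarrow> 'a poly vec set" where
  "dual_code n C = {f \<in> carrier_vec n. \<forall>c\<in>C. f \<bullet> c = 0}"

definition self_dual :: "nat \<Rightarrow> 'a::{field,finite} poly vec set \<Rightarrow> bool" where
  "self_dual n C \<longleftrightarrow> C = dual_code n C"

end

theory Submission
  imports Defs
begin

text \<open>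
  The rows of the extended matrix are pairwise orthogonal, because
  \<open>f \<bullet> f = - 1 / a\<^sup>2\<close> and \<open>a\<^sup>2 + b\<^sup>2 = 0\<close>. Conversely, let \<open>(u, v, w)\<close> be
  orthogonal to all of them and put \<open>t = a u + b v\<close>. Orthogonality to the rows below the
  first says that \<open>c = w + t f\<close> lies in the dual of \<open>C\<close>, which is \<open>C\<close> itself, and
  orthogonality to the first row gives \<open>u = a (f \<bullet> w)\<close>. Hence \<open>(u, v, w)\<close> is \<open>-t\<close> times the
  first row plus the image of \<open>c\<close> under the linear map
  \<open>g \<mapsto> (a (f \<bullet> g), b (f \<bullet> g), g)\<close>, so it lies in the span of the rows.
\<close>

definition orthogonal_lift :: "'r::comm_ring_1 \<Rightarrow> 'r \<Rightarrow> 'r vec \<Rightarrow> 'r vec \<Rightarrow> 'r vec" where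
  "orthogonal_lift \<alpha> \<beta> f g = vCons (\<alpha> * (f \<bullet> g)) (vCons (\<beta> * (f \<bullet> g)) g)"

section \<open>Prepended coordinates and linearity of the lift\<close>

lemma vCons_add: "dim_vec v = dim_vec w \<Longrightarrow> vCons x v + vCons y w = vCons (x + y) (v + w)"
proof (rule eq_vecI)
  fix i assume "dim_vec v = dim_vec w" "i < dim_vec (vCons (x + y) (v + w))"
  then show "(vCons x v + vCons y w) $ i = vCons (x + y) (v + w) $ i"
    by (cases i) auto
qed simp

lemma vCons_smult: "c \<cdot>\<^sub>v vCons x v = vCons (c * x) (c \<cdot>\<^sub>v v)"
proof (rule eq_vecI)
  fix i assume "i < dim_vec (vCons (c * x) (c \<cdot>\<^sub>v v))"
  then show "(c \<cdot>\<^sub>v vCons x v) $ i = vCons (c * x) (c \<cdot>\<^sub>v v) $ i"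
    by (cases i) auto
qed simp

lemma vCons_if_carrier_vec_Suc:
  assumes "v \<in> carrier_vec (Suc n)"
  shows "\<exists>x w. v = vCons x w \<and> w \<in> carrier_vec n"
  using assms by (cases v) auto

lemma orthogonal_lift_carrier [simp]:
  "g \<in> carrier_vec m \<Longrightarrow> orthogonal_lift \<alpha> \<beta> f g \<in> carrier_vec (Suc (Suc m))"
  by (simp add: orthogonal_lift_def)

lemma orthogonal_lift_add:
  assumes "f \<in> carrier_vec m" "g \<in> carrier_vec m" "h \<in> carrier_vec m"
  shows "orthogonal_lift \<alpha> \<beta> f (g + h) = orthogonal_lift \<alpha> \<beta> f g + orthogonal_lift \<alpha> \<beta> f h"
  using assms by (simp add: orthogonal_lift_def vCons_add scalar_prod_add_distrib algebra_simps)

lemma orthogonal_lift_smult: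
  assumes "f \<in> carrier_vec m" "g \<in> carrier_vec m"
  shows "orthogonal_lift \<alpha> \<beta> f (c \<cdot>\<^sub>v g) = c \<cdot>\<^sub>v orthogonal_lift \<alpha> \<beta> f g"
  using assms by (simp add: orthogonal_lift_def vCons_smult algebra_simps)

text \<open>The argument survives as the tail of its lift.\<close>

lemma inj_orthogonal_lift: "inj_on (orthogonal_lift \<alpha> \<beta> f) A"
  by (intro inj_onI) (simp add: orthogonal_lift_def)

text \<open>Coefficients are functions on the vectors of a set. Injectivity keeps the images of
  distinct vectors apart, so that pulling \<open>d\<close> back along \<open>\<psi>\<close> gives
  each vector of \<open>A\<close> the coefficient of its own image.\<close>

lemma linear_image_lincomb:
  fixes \<psi> :: "'r::comm_ring_1 vec \<Rightarrow> 'r vec"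
  assumes "finite A" "A \<subseteq> carrier_vec m" "inj_on \<psi> A"
    and carr: "\<And>v. v \<in> carrier_vec m \<Longrightarrow> \<psi> v \<in> carrier_vec n"
    and add: "\<And>v w. v \<in> carrier_vec m \<Longrightarrow> w \<in> carrier_vec m \<Longrightarrow> \<psi> (v + w) = \<psi> v + \<psi> w"
    and smult: "\<And>c v. v \<in> carrier_vec m \<Longrightarrow> \<psi> (c \<cdot>\<^sub>v v) = c \<cdot>\<^sub>v \<psi> v"
  shows "LinearCombinations.module.lincomb (module_vec TYPE('r) n) d (\<psi> ` A) =
    \<psi> (LinearCombinations.module.lincomb (module_vec TYPE('r) m) (d \<circ> \<psi>) A)"
  using assms(1-3)
proof (induction A rule: finite_induct)
  interpret M: vec_module "TYPE('r)" m .
  interpret N: vec_module "TYPE('r)" n .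
  case empty
  have "\<psi> (0\<^sub>v m) = 0\<^sub>v n"
    using smult[of "0\<^sub>v m" 0] carr[of "0\<^sub>v m"] by simp
  then show ?case by (simp add: M.lincomb_def N.lincomb_def)
next
  interpret M: vec_module "TYPE('r)" m .
  interpret N: vec_module "TYPE('r)" n .
  case (insert x A)
  have x: "x \<in> carrier_vec m" and A: "A \<subseteq> carrier_vec m" using insert by auto
  have new: "\<psi> x \<notin> \<psi> ` A" using insert by (auto simp: inj_on_def)
  have im: "\<psi> ` A \<subseteq> carrier_vec n" using A carr by auto
  have "N.lincomb d (insert (\<psi> x) (\<psi> ` A)) = d (\<psi> x) \<cdot>\<^sub>v \<psi> x + N.lincomb d (\<psi> ` A)"
    unfolding N.lincomb_def using insert(1) new im carr[OF x] by (subst N.finsum_insert) auto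
  moreover have "M.lincomb (d \<circ> \<psi>) (insert x A) = d (\<psi> x) \<cdot>\<^sub>v x + M.lincomb (d \<circ> \<psi>) A"
    unfolding M.lincomb_def using insert(1,2) A x by (subst M.finsum_insert) auto
  moreover have "M.lincomb (d \<circ> \<psi>) A \<in> carrier_vec m" using A by (rule M.lincomb_closed)
  ultimately show ?case using insert.IH[OF A] insert.prems x
    by (simp add: add smult del: comp_apply)
qed

section \<open>Duals of spans\<close>

lemma submodule_dual_code:
  assumes "S \<subseteq> carrier_vec n"
  shows "LinearCombinations.submodule class_ring (dual_code n S) (poly_space n)"
proof -
  interpret vec_module "TYPE('a poly)" n .
  show ?thesis
    unfolding submodule_def dual_code_def using assms
    by (auto simp: module_vec_simps subset_iff module_axioms add_scalar_prod_distrib)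
qed

text \<open>Allows orthogonality to a code to be tested on generators. Orthogonality is symmetric,
  so \<open>h\<close> is orthogonal to \<open>S\<close> iff \<open>S\<close> lies in the dual of
  \<open>{h}\<close>; that dual is a submodule and hence contains the whole span.\<close>

lemma dual_code_span:
  assumes "S \<subseteq> carrier_vec n"
  shows "dual_code n (LinearCombinations.module.span class_ring (poly_space n) S) = dual_code n S"
proof -
  interpret vec_module "TYPE('a poly)" n .
  have "h \<in> dual_code n (span S)" if h: "h \<in> dual_code n S" for h
  proof -
    have hc: "{h} \<subseteq> carrier_vec n" using h by (simp add: dual_code_def)
    have "S \<subseteq> dual_code n {h}"
      using h assms by (auto simp: dual_code_def subset_iff comm_scalar_prod[of _ n h])
    then have "span S \<subseteq> dual_code n {h}"
      by (rule span_is_subset[OF _ submodule_dual_code[OF hc]])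
    then show ?thesis
      using hc by (auto simp: dual_code_def subset_iff comm_scalar_prod[of h n])
  qed
  moreover have "S \<subseteq> span S" using assms by (rule in_own_span)
  ultimately show ?thesis by (auto simp: dual_code_def)
qed

section \<open>The extended rows, with \<open>\<alpha>\<close>, \<open>\<beta>\<close>,
  \<open>\<gamma>\<close> standing for the constants \<open>a\<close>, \<open>b\<close>,
  \<open>inverse a\<close> and \<open>B\<close> for the rows of \<open>G\<close>\<close>

context
  fixes m :: nat and \<alpha> \<beta> \<gamma> :: "'a::{field,finite} poly" and f :: "'a poly vec" and B C :: "'a poly vec set"
  assumes unit: "\<alpha> * \<gamma> = 1"
    and squares: "\<alpha>\<^sup>2 + \<beta>\<^sup>2 = 0"
    and f: "f \<in> carrier_vec m"
    and ff: "f \<bullet> f = - \<gamma>\<^sup>2"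
    and fin: "finite B"
    and basis: "is_basis m C B"
    and dual: "self_dual m C"
begin

interpretation M: vec_module "TYPE('a poly)" m .
interpretation N: vec_module "TYPE('a poly)" "Suc (Suc m)" .

abbreviation "lift \<equiv> orthogonal_lift \<alpha> \<beta> f"
abbreviation "head \<equiv> vCons (- \<gamma>) (vCons 0 f)"

lemma B_carrier: "B \<subseteq> carrier_vec m"
  using basis dual by (auto simp: is_basis_def self_dual_def dual_code_def)

lemma head_carrier: "head \<in> carrier_vec (Suc (Suc m))"
  using f by simp

lemma extension_carrier: "insert head (lift ` B) \<subseteq> carrier_vec (Suc (Suc m))"
  using B_carrier head_carrier by auto

lemma beta_nonzero: "\<beta> \<noteq> 0"
  using squares unit by (auto simp: power2_eq_square)

text \<open>The second coordinate 0 would force \<open>f \<bullet> g = 0\<close>, hence first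
  coordinate 0, whereas \<open>\<gamma>\<close> is a unit. So \<open>head\<close> is a genuinely new
  row, and its term splits off from any linear combination.\<close>

lemma head_notin_lift: "head \<notin> range lift"
proof
  assume "head \<in> range lift"
  then obtain g where "head = lift g" by blast
  then have "- \<gamma> = \<alpha> * (f \<bullet> g)" "\<beta> * (f \<bullet> g) = 0"
    unfolding orthogonal_lift_def vCons_eq_vCons by (blast, metis)
  then show False using beta_nonzero unit by auto
qed

lemma lincomb_lift:
  "N.lincomb d (lift ` B) = lift (M.lincomb (d \<circ> lift) B)"
  using f by (intro linear_image_lincomb fin B_carrier inj_orthogonal_lift)
    (auto simp: orthogonal_lift_add orthogonal_lift_smult)

lemma lincomb_extension:
  "N.lincomb d (insert head (lift ` B)) = d head \<cdot>\<^sub>v head + lift (M.lincomb (d \<circ> lift) B)"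
proof -
  have "N.lincomb d (insert head (lift ` B)) = d head \<cdot>\<^sub>v head + N.lincomb d (lift ` B)"
    unfolding N.lincomb_def using fin head_notin_lift extension_carrier
    by (subst N.finsum_insert) auto
  then show ?thesis by (simp add: lincomb_lift)
qed

text \<open>The second coordinate of a vanishing combination gives \<open>f \<bullet> c = 0\<close>,
  the first then makes the coefficient of \<open>head\<close> zero, and the tail leaves
  \<open>c = 0\<close>, to which independence of \<open>B\<close> applies.\<close>

lemma extension_independent: "N.lin_indpt (insert head (lift ` B))"
proof (rule N.finite_lin_indpt2)
  fix d
  assume "N.lincomb d (insert head (lift ` B)) = 0\<^sub>v (Suc (Suc m))"
  define c where "c = M.lincomb (d \<circ> lift) B"
  have c: "c \<in> carrier_vec m" unfolding c_def using B_carrier by auto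
  have zero: "d head \<cdot>\<^sub>v head + lift c = 0\<^sub>v (Suc (Suc m))"
    using \<open>N.lincomb d _ = _\<close> by (simp only: lincomb_extension c_def)
  have eq: "d head \<cdot>\<^sub>v head + lift c =
      vCons (\<alpha> * (f \<bullet> c) - d head * \<gamma>) (vCons (\<beta> * (f \<bullet> c)) (d head \<cdot>\<^sub>v f + c))"
    using f c by (simp add: vCons_smult orthogonal_lift_def vCons_add)
  have "0\<^sub>v (Suc (Suc m)) = vCons 0 (vCons 0 (0\<^sub>v m :: 'a poly vec))"
    by (simp add: zero_vec_Suc)
  then have coords: "\<alpha> * (f \<bullet> c) - d head * \<gamma> = 0" "\<beta> * (f \<bullet> c) = 0" "d head \<cdot>\<^sub>v f + c = 0\<^sub>v m"
    using zero unfolding eq by auto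
  then have d0: "d head = 0"
    using beta_nonzero unit by auto
  then have "c = 0\<^sub>v m" using coords(3) f c by simp
  then have "\<forall>v\<in>B. (d \<circ> lift) v = 0"
    using basis fin unfolding is_basis_def c_def M.lin_dep_def by fastforce
  then show "\<forall>v\<in>insert head (lift ` B). d v = 0" using d0 by simp
qed (use fin extension_carrier in auto)

text \<open>In \<open>head \<bullet> head\<close> the term \<open>\<gamma>\<^sup>2\<close> cancels
  \<open>f \<bullet> f\<close>; in \<open>head \<bullet> lift g\<close> the two terms cancel because
  \<open>\<alpha> * \<gamma> = 1\<close>; and \<open>lift\<close> preserves scalar products because
  \<open>\<alpha>\<^sup>2 + \<beta>\<^sup>2 = 0\<close>.\<close>

lemma extension_orthogonal: "insert head (lift ` B) \<subseteq> dual_code (Suc (Suc m)) (insert head (lift ` B))"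
proof -
  have BB: "g \<bullet> h = 0" if "g \<in> B" "h \<in> B" for g h
    using that basis dual by (auto simp: is_basis_def self_dual_def dual_code_def)
  have hh: "head \<bullet> head = 0" by (simp add: ff power2_eq_square)
  have hl: "head \<bullet> lift g = 0" for g
    using unit by (simp add: orthogonal_lift_def algebra_simps)
  have ll: "lift g \<bullet> lift h = 0" if "g \<in> B" "h \<in> B" for g h
  proof -
    have "lift g \<bullet> lift h = (\<alpha>\<^sup>2 + \<beta>\<^sup>2) * ((f \<bullet> g) * (f \<bullet> h))"
      by (simp add: orthogonal_lift_def BB that power2_eq_square algebra_simps)
    then show ?thesis by (simp add: squares)
  qed
  have "lift g \<bullet> head = 0" if "g \<in> B" for g
    using hl[of g] comm_scalar_prod[of "lift g" "Suc (Suc m)" head] that extension_carrier by auto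
  then show ?thesis using extension_carrier hh hl ll by (auto simp: dual_code_def)
qed

lemma extension_dual_subset_span:
  "dual_code (Suc (Suc m)) (insert head (lift ` B)) \<subseteq> N.span (insert head (lift ` B))"
proof
  fix x assume x: "x \<in> dual_code (Suc (Suc m)) (insert head (lift ` B))"
  then have "x \<in> carrier_vec (Suc (Suc m))" by (simp add: dual_code_def)
  then obtain u v w where x_eq: "x = vCons u (vCons v w)" and w: "w \<in> carrier_vec m"
    by (metis vCons_if_carrier_vec_Suc)
  define t where "t = \<alpha> * u + \<beta> * v"
  define c where "c = w + t \<cdot>\<^sub>v f"
  have c: "c \<in> carrier_vec m" using w f by (simp add: c_def)
  have "c \<bullet> g = 0" if "g \<in> B" for g
  proof -
    have g: "g \<in> carrier_vec m" using that B_carrier by auto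
    \<comment> \<open>The two new coordinates of \<open>x\<close> contribute
      \<open>t * (f \<bullet> g)\<close> in total.\<close>
    have "c \<bullet> g = x \<bullet> lift g"
      using g w f by (simp add: c_def x_eq t_def orthogonal_lift_def add_scalar_prod_distrib algebra_simps)
    then show ?thesis using x that by (simp add: dual_code_def)
  qed
  then have "c \<in> dual_code m B" using c by (simp add: dual_code_def)
  then have "c \<in> C"
    using basis dual dual_code_span[OF B_carrier] by (simp add: is_basis_def self_dual_def)
  then obtain e where e: "c = M.lincomb e B"
    using basis M.finite_in_span[OF fin B_carrier] by (force simp: is_basis_def)
  have fc: "f \<bullet> c = f \<bullet> w - t * \<gamma>\<^sup>2"
    using f w by (simp add: c_def scalar_prod_add_distrib[of _ m] ff)
  have "x \<bullet> head = 0" using x by (simp add: dual_code_def)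
  then have fw: "f \<bullet> w = \<gamma> * u"
    using f w by (simp add: x_eq comm_scalar_prod[of w m f] algebra_simps)
  \<comment> \<open>This identity and the next one compute the first two coordinates of
    \<open>(- t) \<cdot>\<^sub>v head + lift c\<close>.\<close>
  have u: "\<alpha> * (f \<bullet> c) + t * \<gamma> = u"
  proof -
    have "\<alpha> * (f \<bullet> c) + t * \<gamma> = (\<alpha> * \<gamma>) * u + t * \<gamma> * (1 - \<alpha> * \<gamma>)"
      by (simp add: fc fw power2_eq_square algebra_simps)
    then show ?thesis by (simp add: unit)
  qed
  have v: "\<beta> * (f \<bullet> c) = v"
  proof -
    \<comment> \<open>Grouped so that \<open>unit\<close> removes \<open>u\<close>; what remains is
      turned into \<open>v\<close> by replacing \<open>- \<beta>\<^sup>2\<close> with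
      \<open>\<alpha>\<^sup>2\<close>.\<close>
    have "f \<bullet> c = \<gamma> * u * (1 - \<alpha> * \<gamma>) - \<beta> * \<gamma>\<^sup>2 * v"
      by (simp add: fc fw t_def power2_eq_square algebra_simps)
    then have "\<beta> * (f \<bullet> c) = - \<beta>\<^sup>2 * \<gamma>\<^sup>2 * v"
      by (simp add: unit power2_eq_square)
    also have "- \<beta>\<^sup>2 = \<alpha>\<^sup>2" using squares by (simp add: add_eq_0_iff)
    also have "\<alpha>\<^sup>2 * \<gamma>\<^sup>2 = 1" by (simp add: unit flip: power_mult_distrib)
    finally show ?thesis by simp
  qed
  have "x = (- t) \<cdot>\<^sub>v head + lift c"
  proof -
    have "(- t) \<cdot>\<^sub>v f + c = w" using f w by (intro eq_vecI) (auto simp: c_def)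
    then show ?thesis
      using f c u v by (simp add: x_eq vCons_smult orthogonal_lift_def vCons_add add.commute)
  qed
  \<comment> \<open>The coefficient of a lifted row is that of its preimage in \<open>B\<close>; the
    case split is unambiguous since \<open>head\<close> is not a lift.\<close>
  also have "\<dots> = N.lincomb (\<lambda>z. if z = head then - t else e (inv_into B lift z)) (insert head (lift ` B))"
  proof -
    have "M.lincomb ((\<lambda>z. if z = head then - t else e (inv_into B lift z)) \<circ> lift) B = M.lincomb e B"
      using B_carrier head_notin_lift
      by (intro M.lincomb_cong) (auto simp: inj_orthogonal_lift, metis rangeI)
    then show ?thesis by (simp only: lincomb_extension e) simp
  qed
  finally show "x \<in> N.span (insert head (lift ` B))"
    unfolding N.span_def using fin by blast
qed

text \<open>By \<open>dual_code_span\<close> only the dual of the generating set matters. It is a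
  submodule containing the generators, hence their span; the reverse inclusion is
  \<open>extension_dual_subset_span\<close>.\<close>

lemma extension_self_dual: "self_dual (Suc (Suc m)) (N.span (insert head (lift ` B)))"
proof -
  have "N.span (insert head (lift ` B)) \<subseteq> dual_code (Suc (Suc m)) (insert head (lift ` B))"
    by (rule N.span_is_subset[OF extension_orthogonal submodule_dual_code[OF extension_carrier]])
  then show ?thesis
    using extension_dual_subset_span
    unfolding self_dual_def dual_code_span[OF extension_carrier] by (rule subset_antisym)
qed

lemma extension_basis: "is_basis (Suc (Suc m)) (N.span (insert head (lift ` B))) (insert head (lift ` B))"
  using extension_independent N.in_own_span[OF extension_carrier] by (simp add: is_basis_def)

end

section \<open>Passage from the set of rows to the matrix\<close>

theorem proposition3:
  fixes p l k :: nat
    and a b :: "'a::{field,finite}"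
    and C :: "'a poly vec set"
    and G :: "'a poly mat"
    and f :: "'a poly vec"
    and y :: "nat \<Rightarrow> 'a poly"
  assumes "prime p"
    and "card (UNIV :: 'a set) = p ^ l"
    and "\<not> (p mod 4 = 3 \<and> odd l)"
    and "convolutional_code (2 * k) k C"
    and "self_dual (2 * k) C"
    and "generator_matrix (2 * k) k C G"
    and "a \<noteq> 0" and "b \<noteq> 0"
    and "a\<^sup>2 + b\<^sup>2 = 0"
    and "f \<in> carrier_vec (2 * k)"
    and "f \<bullet> f = [:- (inverse a)\<^sup>2:]"
    and "\<And>i. i < k \<Longrightarrow> y i = f \<bullet> row G i"
  shows "\<exists>C'. convolutional_code (2 * k + 2) (k + 1) C' \<and>
      self_dual (2 * k + 2) C' \<and>
      generator_matrix (2 * k + 2) (k + 1) C'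
        (mat_of_rows (2 * k + 2)
          ((vec_of_list [[:- inverse a:], 0] @\<^sub>v f) #
           map (\<lambda>i. vec_of_list [[:a:] * y i, [:b:] * y i] @\<^sub>v row G i) [0..<k]))"
proof -
  interpret N: vec_module "TYPE('a poly)" "Suc (Suc (2 * k))" .
  let ?B = "set (rows G)"
  define L where "L = orthogonal_lift [:a:] [:b:] f"
  define h where "h = vCons (- [:inverse a:]) (vCons 0 f)"
  define R where "R = h # map L (rows G)"
  have G: "G \<in> carrier_mat k (2 * k)" "distinct (rows G)" "is_basis (2 * k) C ?B"
    using assms(6) by (auto simp: generator_matrix_def)
  have unit: "[:a:] * [:inverse a:] = 1" using assms(7) by simp
  have squares: "[:a:]\<^sup>2 + [:b:]\<^sup>2 = 0"
    using assms(9) by (simp add: power2_eq_square)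
  have ff: "f \<bullet> f = - [:inverse a:]\<^sup>2"
    using assms(11) by (simp add: power2_eq_square)
  note ext = unit squares assms(10) ff finite_set G(3) assms(5)
  have set_R: "set R = insert h (L ` ?B)" by (simp add: R_def)
  have carrier: "set R \<subseteq> carrier_vec (Suc (Suc (2 * k)))"
    unfolding set_R h_def L_def by (rule extension_carrier[OF ext])
  have distinct: "distinct R"
    \<comment> \<open>The lift is injective on the distinct rows of \<open>G\<close>, and
      \<open>h\<close> lies outside its range. Distinctness also turns the length
      \<open>k + 1\<close> of \<open>R\<close> into the cardinality of the basis.\<close>
    using head_notin_lift[OF ext] G(2) inj_orthogonal_lift
    by (auto simp: R_def distinct_map L_def h_def)
  have length: "length R = k + 1" using G(1) by (simp add: R_def)
  have basis: "is_basis (Suc (Suc (2 * k))) (N.span (set R)) (set R)"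
    unfolding set_R h_def L_def by (rule extension_basis[OF ext])
  have "rows G = map (row G) [0..<k]" using G(1) by (simp add: rows_def)
  \<comment> \<open>Since \<open>y i\<close> is \<open>f \<bullet> row G i\<close>, each lower row
    is the lift of \<open>row G i\<close>.\<close>
  then have R_eq: "(vec_of_list [[:- inverse a:], 0] @\<^sub>v f) #
      map (\<lambda>i. vec_of_list [[:a:] * y i, [:b:] * y i] @\<^sub>v row G i) [0..<k] = R"
    using assms(12) by (simp add: R_def L_def h_def orthogonal_lift_def)
  have "convolutional_code (Suc (Suc (2 * k))) (k + 1) (N.span (set R))"
    unfolding convolutional_code_def
    using N.span_is_submodule[OF carrier] basis distinct_card[OF distinct] length by auto
  moreover have "self_dual (Suc (Suc (2 * k))) (N.span (set R))"
    unfolding set_R h_def L_def by (rule extension_self_dual[OF ext])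
  moreover have "generator_matrix (Suc (Suc (2 * k))) (k + 1) (N.span (set R)) (mat_of_rows (Suc (Suc (2 * k))) R)"
    using carrier basis distinct length by (auto simp: generator_matrix_def)
  ultimately show ?thesis unfolding R_eq by auto
qed

end
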